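(* Let $k\ge1$ and $d\ge2k+1$ be integers, and let $\eta,L>0$. There exist a positive integer $n_k\le1000^{k+1}$, a convex globally $L$-Lipschitz function $f:\mathbb{R}^d\to\mathbb{R}$ with $0\in\operatorname*{argmin}_{x\in\mathbb{R}^d}f(x)$, and points $x_1,\dots,x_{n_k}\in\mathbb{R}^d$ and vectors $g_t\in\partial f(x_t)$ ($1\le t<n_k$) with $$x_1=0,\qquad x_{t+1}=x_t-\eta g_t\quad(1\le t<n_k),$$ such that, writing $f_\star:=\min_{x\in\mathbb{R}^d}f(x)$, $$f(x_{n_k})-f_\star=\frac{k}{4}\,\eta L^2.$$ Moreover, the same terminal gap can be attained at every horizon $n\ge n_k$ by prefixing zero-subgradient updates at the minimizer: for every integer $n\ge n_k$, one has $0\in\partial f(0)$, and the trajectory of length $n$ that starts at $0$, first performs $n-n_k$ updates with the zero subgradient at $0$, and then follows the updates with $g_1,\dots,g_{n_k-1}$, is a valid trajectory of the same method whose last point $\tilde x_n$ satisfies $f(\tilde x_n)-f_\star=\frac{k}{4}\eta L^2$.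
   Context: $\lVert\cdot\rVert$ and $\langle\cdot,\cdot\rangle$ are the Euclidean norm and inner product on $\mathbb{R}^d$. $f$ is globally $L$-Lipschitz if $|f(x)-f(y)|\le L\lVert x-y\rVert$ for all $x,y\in\mathbb{R}^d$. $\partial f(x)$ is the set of subgradients of $f$ at $x$, i.e. the vectors $g\in\mathbb{R}^d$ with $f(y)\ge f(x)+\langle g,y-x\rangle$ for every $y\in\mathbb{R}^d$. A valid trajectory of length $n$ of the unconstrained constant-step method is a sequence $x_1,\dots,x_n$ with $x_{t+1}=x_t-\eta g_t$ for some $g_t\in\partial f(x_t)$, $1\le t<n$. *)

theory Defs
  imports "HOL-Analysis.Analysis"
begin

definition subdifferential :: "('a::real_inner \<Rightarrow> real) \<Rightarrow> 'a \<Rightarrow> 'a set" where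
  "subdifferential f x = {g. \<forall>y. f y \<ge> f x + g \<bullet> (y - x)}"

text \<open>
  Sequences are indexed from 1: only \<open>x 1, \<dots>, x n\<close> and \<open>g 1, \<dots>, g (n - 1)\<close> are constrained.
  The points form a valid trajectory of length \<open>n\<close> for step size \<open>\<eta>\<close>, with the vectors \<open>g t\<close>
  as the subgradients chosen along the way.
\<close>
definition subgradient_trajectory ::
  "('a::real_inner \<Rightarrow> real) \<Rightarrow> real \<Rightarrow> nat \<Rightarrow> (nat \<Rightarrow> 'a) \<Rightarrow> (nat \<Rightarrow> 'a) \<Rightarrow> bool" where
  "subgradient_trajectory f \<eta> n x g \<longleftrightarrow>
     (\<forall>t. 1 \<le> t \<and> t < n \<longrightarrow> g t \<in> subdifferential f (x t) \<and> x (t + 1) = x t - \<eta> *\<^sub>R g t)"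

text \<open>The 1-indexed sequence consisting of \<open>m\<close> zeros followed by \<open>g 1, g 2, \<dots>\<close>\<close>
definition prefix_zeros :: "nat \<Rightarrow> (nat \<Rightarrow> 'a::zero) \<Rightarrow> nat \<Rightarrow> 'a" where
  "prefix_zeros m g t = (if t \<le> m then 0 else g (t - m))"

text \<open>The least element of the range; meaningful only when the minimum is attained.\<close>
definition min_value :: "('a \<Rightarrow> real) \<Rightarrow> real" where
  "min_value f = (LEAST v. v \<in> range f)"

end

theory Submission
  imports Defs
begin

text \<open>
  It suffices to find, for unit step size, a convex \<open>1\<close>-Lipschitz function \<open>F \<ge> 0 = F 0\<close> on which
  the method climbs from \<open>0\<close> to a height of at least \<open>k / 4\<close>. Replacing \<open>F\<close> by
  \<open>\<eta> c\<^sup>2 F (x / (\<eta> c))\<close> turns step size \<open>1\<close> into step size \<open>\<eta>\<close>, makes the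
  Lipschitz constant \<open>c\<close>, and multiplies heights by \<open>\<eta> c\<^sup>2\<close>. A suitable \<open>c \<le> L\<close> then gives
  the required gap exactly, however much higher than \<open>k / 4\<close> the climb goes.

  \<open>F\<close> is the support function of a set of slopes, a maximum of linear functions: a slope is a
  subgradient wherever it attains the maximum. The trajectory runs through \<open>k\<close> stages, each gaining
  about \<open>7/25\<close>, and each a hundred times shorter than the previous one. Stage \<open>s\<close> has its own two
  orthonormal directions. Along \<open>v s\<close> the iterate zigzags between the two sides of the valley
  \<open>4/5 * \<bar>v s \<bullet> x\<bar>\<close>, at coordinate \<open>\<plusminus>2/5\<close> and hence at height \<open>8/25\<close> above its bottom. Meanwhile it
  drifts slowly along \<open>u s\<close>. All later slopes reward this drift: they contain \<open>u s\<close> with a positive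
  coefficient \<open>a\<close>, so the drift stores potential for them. They ignore \<open>v s\<close>, and so they remain hidden
  below the zigzag until the stored potential has grown to the zigzag height \<open>8/25\<close>, less the
  small amount lost by drifting downhill. At that moment stage \<open>s + 1\<close> takes over from exactly the
  current height, and its own zigzag adds another \<open>8/25\<close> on top.

  What the later stages cost is the potential they consume: each of their steps lowers \<open>u s\<close> by \<open>a\<close>.
  With a drift of \<open>\<delta>\<close> per step over \<open>T\<close> steps, and \<open>a = 7 \<delta>\<close>, the takeover condition is
  \<open>8 \<delta>\<^sup>2 T = 8/25\<close>. All later stages together last at most \<open>T / 99\<close> steps and consume at most
  \<open>49 \<delta>\<^sup>2 T / 99 = 49 / 2475\<close> of the \<open>7/25\<close>, which leaves at least \<open>1/4\<close> per stage. Since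
  \<open>\<delta> = 1 / (5 \<surd>T)\<close>, the squares of the \<open>a\<close>'s form a small geometric series and all slopes have norm
  at most \<open>1\<close>. The heart of the proof is \<open>slope_active\<close>, which verifies that the slope used by a stage
  does attain the maximum throughout that stage.
\<close>

section \<open>Support functions of bounded sets\<close>

definition support_fun :: "'a::real_inner set \<Rightarrow> 'a \<Rightarrow> real" where
  "support_fun G x = (SUP g\<in>G. g \<bullet> x)"

lemma bdd_above_inner:
  fixes G :: "'a::real_inner set"
  assumes "\<And>g. g \<in> G \<Longrightarrow> norm g \<le> M"
  shows "bdd_above ((\<lambda>g. g \<bullet> x) ` G)"
proof (rule bdd_aboveI2)
  fix g assume "g \<in> G"
  then have "norm g * norm x \<le> M * norm x"
    by (intro mult_right_mono assms) auto
  then show "g \<bullet> x \<le> M * norm x"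
    using norm_cauchy_schwarz[of g x] by linarith
qed

lemma inner_le_support_fun:
  assumes "\<And>g. g \<in> G \<Longrightarrow> norm g \<le> M" "g \<in> G"
  shows "g \<bullet> x \<le> support_fun G x"
  unfolding support_fun_def using assms by (intro cSUP_upper bdd_above_inner) auto

lemma support_fun_le:
  assumes "G \<noteq> {}" "\<And>g. g \<in> G \<Longrightarrow> g \<bullet> x \<le> b"
  shows "support_fun G x \<le> b"
  unfolding support_fun_def using assms by (intro cSUP_least) auto

lemma convex_on_support_fun:
  assumes "G \<noteq> {}" "\<And>g. g \<in> G \<Longrightarrow> norm g \<le> M"
  shows "convex_on UNIV (support_fun G)"
proof (intro convex_onI)
  fix t :: real and x y :: 'a
  assume t: "0 < t" "t < 1"
  show "support_fun G ((1 - t) *\<^sub>R x + t *\<^sub>R y)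
      \<le> (1 - t) * support_fun G x + t * support_fun G y"
  proof (rule support_fun_le[OF assms(1)])
    fix g assume g: "g \<in> G"
    have "(1 - t) * (g \<bullet> x) \<le> (1 - t) * support_fun G x" "t * (g \<bullet> y) \<le> t * support_fun G y"
      using t inner_le_support_fun[OF assms(2) g] by (auto intro: mult_left_mono)
    then show "g \<bullet> ((1 - t) *\<^sub>R x + t *\<^sub>R y)
        \<le> (1 - t) * support_fun G x + t * support_fun G y"
      by (simp add: inner_add_right)
  qed
qed auto

lemma lipschitz_on_support_fun:
  assumes "G \<noteq> {}" "\<And>g. g \<in> G \<Longrightarrow> norm g \<le> M"
  shows "lipschitz_on M UNIV (support_fun G)"
proof (rule lipschitz_onI)
  have bound: "support_fun G x \<le> support_fun G y + M * dist x y" for x y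
  proof (rule support_fun_le[OF assms(1)])
    fix g assume g: "g \<in> G"
    have "g \<bullet> (x - y) \<le> norm g * norm (x - y)" by (rule norm_cauchy_schwarz)
    also have "\<dots> \<le> M * norm (x - y)" using assms(2)[OF g] by (intro mult_right_mono) auto
    finally show "g \<bullet> x \<le> support_fun G y + M * dist x y"
      using inner_le_support_fun[OF assms(2) g, of y] by (simp add: inner_diff_right dist_norm)
  qed
  show "dist (support_fun G x) (support_fun G y) \<le> M * dist x y" for x y
    using bound[of x y] bound[of y x] by (auto simp: dist_real_def dist_commute)
  obtain g where "g \<in> G" using assms(1) by blast
  then show "0 \<le> M" using assms(2)[of g] norm_ge_zero[of g] by linarith
qed

lemma maximizer_in_subdifferential_support_fun:
  assumes "\<And>g. g \<in> G \<Longrightarrow> norm g \<le> M" "g \<in> G" "\<And>h. h \<in> G \<Longrightarrow> h \<bullet> x \<le> g \<bullet> x"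
  shows "g \<in> subdifferential (support_fun G) x"
proof -
  have "support_fun G x \<le> g \<bullet> x" using assms(2,3) by (intro support_fun_le) auto
  then have "support_fun G x + g \<bullet> (y - x) \<le> support_fun G y" for y
    using inner_le_support_fun[OF assms(1,2), of y] by (simp add: inner_diff_right)
  then show ?thesis by (simp add: subdifferential_def)
qed

section \<open>Trajectories: step relation, rescaling, idle prefix\<close>

text \<open>
  The steps of the method form a relation, so that trajectories are its powers and stages of a
  trajectory compose without bookkeeping of time indices.
\<close>
definition unit_step :: "('a::real_inner \<Rightarrow> real) \<Rightarrow> ('a \<times> 'a) set" where
  "unit_step f = {(x, x - g) | x g. g \<in> subdifferential f x}"

text \<open>
  The change of scale under which unit steps with gradients \<open>g\<close> become steps of size \<open>\<eta>\<close> with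
  gradients \<open>c g\<close>; the points are multiplied by \<open>\<eta> * c\<close>.
\<close>
definition rescale :: "real \<Rightarrow> real \<Rightarrow> ('a::real_inner \<Rightarrow> real) \<Rightarrow> 'a \<Rightarrow> real" where
  "rescale \<eta> c f x = \<eta> * c\<^sup>2 * f (x /\<^sub>R (\<eta> * c))"

lemma subdifferential_rescale:
  assumes "\<eta> > 0" "c > 0" "g \<in> subdifferential f x"
  shows "c *\<^sub>R g \<in> subdifferential (rescale \<eta> c f) ((\<eta> * c) *\<^sub>R x)"
proof -
  have "rescale \<eta> c f ((\<eta> * c) *\<^sub>R x) + (c *\<^sub>R g) \<bullet> (y - (\<eta> * c) *\<^sub>R x) \<le> rescale \<eta> c f y" for y
  proof -
    define z where "z = y /\<^sub>R (\<eta> * c)"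
    have y: "y = (\<eta> * c) *\<^sub>R z" using assms by (simp add: z_def field_simps)
    have "f x + g \<bullet> (z - x) \<le> f z" using assms(3) by (simp add: subdifferential_def)
    then have "\<eta> * c\<^sup>2 * (f x + g \<bullet> (z - x)) \<le> \<eta> * c\<^sup>2 * f z"
      using assms by (intro mult_left_mono) auto
    then show ?thesis using assms(1,2)
      by (simp add: y rescale_def inner_diff_right algebra_simps power2_eq_square)
  qed
  then show ?thesis by (simp add: subdifferential_def)
qed

lemma convex_on_rescale:
  assumes "\<eta> > 0" "c > 0" "convex_on UNIV f"
  shows "convex_on UNIV (rescale \<eta> c f)"
proof (intro convex_onI)
  fix t :: real and x y :: 'a
  assume t: "0 < t" "t < 1"
  let ?s = "inverse (\<eta> * c)"
  have "f ((1 - t) *\<^sub>R (?s *\<^sub>R x) + t *\<^sub>R (?s *\<^sub>R y)) \<le> (1 - t) * f (?s *\<^sub>R x) + t * f (?s *\<^sub>R y)"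
    using t by (intro convex_onD[OF assms(3)]) auto
  also have "(1 - t) *\<^sub>R (?s *\<^sub>R x) + t *\<^sub>R (?s *\<^sub>R y) = ?s *\<^sub>R ((1 - t) *\<^sub>R x + t *\<^sub>R y)"
    by (simp only: scaleR_right_distrib scaleR_left_commute)
  finally have "\<eta> * c\<^sup>2 * f (?s *\<^sub>R ((1 - t) *\<^sub>R x + t *\<^sub>R y))
      \<le> \<eta> * c\<^sup>2 * ((1 - t) * f (?s *\<^sub>R x) + t * f (?s *\<^sub>R y))"
    using assms by (intro mult_left_mono) auto
  then show "rescale \<eta> c f ((1 - t) *\<^sub>R x + t *\<^sub>R y)
      \<le> (1 - t) * rescale \<eta> c f x + t * rescale \<eta> c f y"
    unfolding rescale_def by (simp only: distrib_left mult.left_commute)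
qed auto

lemma lipschitz_on_rescale:
  assumes "\<eta> > 0" "c > 0" "lipschitz_on 1 UNIV f"
  shows "lipschitz_on c UNIV (rescale \<eta> c f)"
proof (rule lipschitz_onI)
  fix x y :: 'a
  let ?s = "inverse (\<eta> * c)"
  have "dist (f (?s *\<^sub>R x)) (f (?s *\<^sub>R y)) \<le> 1 * dist (?s *\<^sub>R x) (?s *\<^sub>R y)"
    by (rule lipschitz_onD[OF assms(3)]) auto
  also have "dist (?s *\<^sub>R x) (?s *\<^sub>R y) = ?s * dist x y"
    using assms by (simp add: dist_norm flip: scaleR_diff_right)
  finally have "\<eta> * c\<^sup>2 * dist (f (?s *\<^sub>R x)) (f (?s *\<^sub>R y)) \<le> \<eta> * c\<^sup>2 * (?s * dist x y)"
    using assms by (intro mult_left_mono) auto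
  moreover have "\<eta> * c\<^sup>2 * (?s * dist x y) = c * dist x y"
    using assms by (simp add: power2_eq_square field_simps)
  moreover have "dist (rescale \<eta> c f x) (rescale \<eta> c f y)
      = \<eta> * c\<^sup>2 * dist (f (?s *\<^sub>R x)) (f (?s *\<^sub>R y))"
    using assms by (simp add: rescale_def dist_real_def abs_mult flip: right_diff_distrib)
  ultimately show "dist (rescale \<eta> c f x) (rescale \<eta> c f y) \<le> c * dist x y" by (simp only:)
qed (use assms in auto)

lemma subgradient_trajectory_of_unit_steps:
  assumes "\<eta> > 0" "c > 0" "(a, b) \<in> unit_step f ^^ N"
  obtains x g where "x 1 = (\<eta> * c) *\<^sub>R a" "x (Suc N) = (\<eta> * c) *\<^sub>R b"
    "subgradient_trajectory (rescale \<eta> c f) \<eta> (Suc N) x g"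
proof -
  obtain X where X: "X 0 = a" "X N = b" "\<forall>i<N. (X i, X (Suc i)) \<in> unit_step f"
    using assms(3) by (auto simp: relpow_fun_conv)
  then have "\<forall>i<N. \<exists>h. h \<in> subdifferential f (X i) \<and> X (Suc i) = X i - h"
    by (auto simp: unit_step_def)
  then obtain h where h: "\<And>i. i < N \<Longrightarrow> h i \<in> subdifferential f (X i)"
      "\<And>i. i < N \<Longrightarrow> X (Suc i) = X i - h i"
    by metis
  show ?thesis
  proof (rule that)
    show "subgradient_trajectory (rescale \<eta> c f) \<eta> (Suc N)
        (\<lambda>t. (\<eta> * c) *\<^sub>R X (t - 1)) (\<lambda>t. c *\<^sub>R h (t - 1))"
      unfolding subgradient_trajectory_def
    proof (intro allI impI conjI)
      fix t assume t: "1 \<le> t \<and> t < Suc N"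
      then have i: "t - 1 < N" "Suc (t - 1) = t" by auto
      show "c *\<^sub>R h (t - 1) \<in> subdifferential (rescale \<eta> c f) ((\<eta> * c) *\<^sub>R X (t - 1))"
        using assms(1,2) h(1)[OF i(1)] by (rule subdifferential_rescale)
      show "(\<eta> * c) *\<^sub>R X (t + 1 - 1) = (\<eta> * c) *\<^sub>R X (t - 1) - \<eta> *\<^sub>R c *\<^sub>R h (t - 1)"
        using h(2)[OF i(1)] i(2) by (simp add: scaleR_diff_right)
    qed
  qed (use X in auto)
qed

text \<open>
  Idling at \<open>0\<close> merely delays the trajectory: \<open>prefix_zeros\<close> applied to the points themselves gives
  the delayed points, because the idle position and the padding value are both \<open>0\<close>.
\<close>
lemma subgradient_trajectory_prefix_zeros:
  assumes "subgradient_trajectory f \<eta> n x g" "x 1 = 0" "0 \<in> subdifferential f 0"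
  shows "subgradient_trajectory f \<eta> (m + n) (prefix_zeros m x) (prefix_zeros m g)"
  unfolding subgradient_trajectory_def
proof (intro allI impI)
  fix t assume t: "1 \<le> t \<and> t < m + n"
  consider "t < m" | "t = m" | "m < t" by linarith
  then show "prefix_zeros m g t \<in> subdifferential f (prefix_zeros m x t) \<and>
      prefix_zeros m x (t + 1) = prefix_zeros m x t - \<eta> *\<^sub>R prefix_zeros m g t"
  proof cases
    case 3
    then have "1 \<le> t - m \<and> t - m < n" using t by auto
    then have "g (t - m) \<in> subdifferential f (x (t - m)) \<and>
        x (t - m + 1) = x (t - m) - \<eta> *\<^sub>R g (t - m)"
      using assms(1) by (simp add: subgradient_trajectory_def)
    then show ?thesis using 3 by (simp add: prefix_zeros_def Suc_diff_le)
  qed (use assms(2,3) in \<open>auto simp: prefix_zeros_def\<close>)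
qed

section \<open>The zigzag construction\<close>

text \<open>
  Two orthonormal directions for each of the \<open>k\<close> stages: \<open>u s\<close> for the drift of stage \<open>s\<close> and
  \<open>v s\<close> for its zigzag.
\<close>
locale orthonormal_pairs =
  fixes u v :: "nat \<Rightarrow> 'a::real_inner" and k :: nat
  assumes k_pos: "0 < k"
    and inner_uu: "r < k \<Longrightarrow> s < k \<Longrightarrow> u r \<bullet> u s = (if r = s then 1 else 0)"
    and inner_vv: "r < k \<Longrightarrow> s < k \<Longrightarrow> v r \<bullet> v s = (if r = s then 1 else 0)"
    and inner_uv: "r < k \<Longrightarrow> s < k \<Longrightarrow> u r \<bullet> v s = 0"
begin

text \<open>
  The drift per step is chosen so that \<open>(drift r)\<^sup>2 * duration r = 1/25\<close>; the durations are powers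
  of \<open>100\<close> to make their square roots integers. The last stage, number \<open>k - 1\<close>, is a single step.
\<close>
definition drift :: "nat \<Rightarrow> real" where
  "drift r = 1 / (5 * 10 ^ (k - Suc r))"

definition duration :: "nat \<Rightarrow> nat" where
  "duration r = 100 ^ (k - Suc r)"

definition stage_start :: "nat \<Rightarrow> nat" where
  "stage_start s = (\<Sum>r<s. duration r)"

text \<open>
  A step subtracts a slope, so the penalty on \<open>u s\<close> makes this coordinate grow, while the rewards for
  earlier drifts use them up. The earlier \<open>v r\<close> do not occur: this hides the slopes of a stage
  until the drifts alone outweigh an earlier zigzag.
\<close>
definition slope :: "nat \<Rightarrow> real \<Rightarrow> 'a" where
  "slope s c = (\<Sum>r<s. (7 * drift r) *\<^sub>R u r) - drift s *\<^sub>R u s + c *\<^sub>R v s"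

text \<open>
  The zero slope keeps the support function nonnegative, so that \<open>0\<close> is a minimiser. Intermediate
  values of \<open>c\<close> are needed for the first step of a stage, which moves from the bottom of the valley
  to a wall at distance \<open>2/5\<close>, half a zigzag step.
\<close>
definition slopes :: "'a set" where
  "slopes = insert 0 {slope s c | s c. s < k \<and> \<bar>c\<bar> \<le> 4/5}"

lemma duration_pos: "0 < duration r"
  by (simp add: duration_def)

lemma drift_square: "(drift r)\<^sup>2 = 1 / (25 * real (duration r))"
  by (simp add: drift_def duration_def power2_eq_square flip: power_mult_distrib)

lemma drift_square_times: "(drift r)\<^sup>2 * real (duration r) = 1/25"
  using duration_pos[of r] by (simp add: drift_square)

lemma stage_start_closed: "s \<le> k \<Longrightarrow> 99 * stage_start s + 100 ^ (k - s) = 100 ^ k"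
proof (induction s)
  case (Suc s)
  then have "(100::nat) ^ (k - s) = 100 * duration s"
    by (simp add: duration_def flip: power_Suc Suc_diff_le)
  moreover have "100 ^ (k - Suc s) = duration s" by (simp add: duration_def)
  ultimately show ?case using Suc by (simp add: stage_start_def)
qed (simp add: stage_start_def)

text \<open>
  Durations shrink by a factor of \<open>100\<close>, so the whole time after stage \<open>r\<close> is less than
  \<open>duration r / 99\<close>. This is what keeps the potential stored in stage \<open>r\<close> from being used up.
\<close>
lemma elapsed_bound:
  assumes "r < s" "s < k" "\<tau> \<le> duration s"
  shows "99 * (stage_start s + \<tau>) \<le> 99 * stage_start (Suc r) + duration r"
proof -
  have "stage_start s + \<tau> \<le> stage_start (Suc s)" using assms by (simp add: stage_start_def)
  moreover have "99 * stage_start (Suc s) \<le> 100 ^ k" using stage_start_closed[of "Suc s"] assms by simp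
  moreover have "99 * stage_start (Suc r) + duration r = 100 ^ k"
    using stage_start_closed[of "Suc r"] assms by (simp add: duration_def)
  ultimately show ?thesis by simp
qed

lemma inner_slope:
  "slope s c \<bullet> x = (\<Sum>r<s. 7 * drift r * (u r \<bullet> x)) - drift s * (u s \<bullet> x) + c * (v s \<bullet> x)"
  by (simp add: slope_def inner_add_left inner_diff_left inner_sum_left)

lemma u_slope:
  assumes "s < k" "r < k"
  shows "u r \<bullet> slope s c = (if r < s then 7 * drift r else if r = s then - drift s else 0)"
proof -
  have "(\<Sum>i<s. 7 * drift i * (u r \<bullet> u i)) = (\<Sum>i<s. if i = r then 7 * drift i else 0)"
    using assms by (intro sum.cong) (auto simp: inner_uu)
  also have "\<dots> = (if r < s then 7 * drift r else 0)" by (simp add: sum.delta)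
  finally show ?thesis using assms
    by (simp add: slope_def inner_add_right inner_diff_right inner_sum_right inner_uu inner_uv)
qed

lemma v_slope:
  assumes "s < k" "r < k"
  shows "v r \<bullet> slope s c = (if r = s then c else 0)"
proof -
  have vu: "v r \<bullet> u i = 0" if "i < k" for i using inner_uv[OF that assms(2)] by (simp add: inner_commute)
  then have "(\<Sum>i<s. 7 * drift i * (v r \<bullet> u i)) = 0"
    using assms by (intro sum.neutral) auto
  then show ?thesis using assms vu
    by (simp add: slope_def inner_add_right inner_diff_right inner_sum_right inner_vv)
qed

lemma sum_drift_squares: "s < k \<Longrightarrow> 99 * (\<Sum>r<s. (drift r)\<^sup>2) \<le> (drift s)\<^sup>2"
proof (induction s)
  case (Suc s)
  then have "k - Suc s = Suc (k - Suc (Suc s))" by simp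
  then have "duration s = 100 * duration (Suc s)"
    by (simp only: duration_def power_Suc)
  then have "(drift (Suc s))\<^sup>2 = 100 * (drift s)\<^sup>2" by (simp add: drift_square)
  then show ?case using Suc by simp
qed simp

lemma drift_square_le: "(drift s)\<^sup>2 \<le> 1/25"
  using duration_pos[of s] by (simp add: drift_square field_simps)

text \<open>
  The zigzag takes \<open>16/25\<close> of the squared norm, the drift at most \<open>1/25\<close>, and the rewards for
  earlier drifts, \<open>49\<close> times a geometric series dominated by its next term, at most
  \<open>49/99 * 1/25\<close>.
\<close>
lemma norm_slopes: "g \<in> slopes \<Longrightarrow> norm g \<le> 1"
proof -
  assume "g \<in> slopes"
  moreover have "norm (slope s c) \<le> 1" if s: "s < k" and c: "\<bar>c\<bar> \<le> 4/5" for s c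
  proof -
    have "slope s c \<bullet> slope s c = (\<Sum>r<s. 49 * (drift r)\<^sup>2) + (drift s)\<^sup>2 + c\<^sup>2"
      using s by (simp add: inner_slope[of s c "slope s c"] u_slope v_slope power2_eq_square)
    also have "\<dots> = 49 * (\<Sum>r<s. (drift r)\<^sup>2) + (drift s)\<^sup>2 + c\<^sup>2"
      by (simp add: sum_distrib_left)
    also have "\<dots> \<le> 1"
      using sum_drift_squares[OF s] drift_square_le[of s] abs_le_square_iff[of c "4/5"] c
      by (simp add: power2_eq_square)
    finally have "(norm (slope s c))\<^sup>2 \<le> 1\<^sup>2" by (simp add: power2_norm_eq_inner)
    then show ?thesis by (rule power2_le_imp_le) simp
  qed
  ultimately show ?thesis by (auto simp: slopes_def)
qed

definition potential :: "nat \<Rightarrow> 'a \<Rightarrow> real" where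
  "potential r x = 7 * drift r * (u r \<bullet> x)"

text \<open>
  What is known of the iterate after \<open>\<tau>\<close> steps of stage \<open>s\<close>. Each potential starts at \<open>7/25\<close> when its
  stage ends and then loses \<open>49 (drift r)\<^sup>2\<close> per step, so that the bound contains the time
  since stage \<open>r\<close> ended. The side of the valley on which the iterate stands is left open, as
  only the distance from the bottom matters for the function value.
\<close>
definition stage_state :: "nat \<Rightarrow> nat \<Rightarrow> 'a \<Rightarrow> bool" where
  "stage_state s \<tau> x \<longleftrightarrow>
     (\<forall>r<s. 7/25 - 49 * (drift r)\<^sup>2 * (real (stage_start s + \<tau>) - real (stage_start (Suc r)))
              \<le> potential r x \<and> \<bar>v r \<bullet> x\<bar> = 2/5) \<and>
     u s \<bullet> x = drift s * real \<tau> \<and> \<bar>v s \<bullet> x\<bar> = (if \<tau> = 0 then 0 else 2/5) \<and>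
     (\<forall>r. s < r \<and> r < k \<longrightarrow> u r \<bullet> x = 0 \<and> v r \<bullet> x = 0)"

text \<open>
  Of the \<open>7/25\<close> stored, the later stages consume at most \<open>49 / 2475\<close>, and
  \<open>1/4\<close> remains.
\<close>
lemma stage_state_potential:
  assumes "stage_state s \<tau> x" "r < s" "s < k" "\<tau> \<le> duration s"
  shows "1/4 \<le> potential r x"
proof -
  let ?e = "real (stage_start s + \<tau>) - real (stage_start (Suc r))"
  have "real (99 * (stage_start s + \<tau>)) \<le> real (99 * stage_start (Suc r) + duration r)"
    using elapsed_bound[OF assms(2-4)] by (simp only: of_nat_le_iff)
  then have "99 * ?e \<le> real (duration r)" by simp
  then have "(drift r)\<^sup>2 * (99 * ?e) \<le> (drift r)\<^sup>2 * real (duration r)"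
    by (rule mult_left_mono) simp
  then have "99 * ((drift r)\<^sup>2 * ?e) \<le> 1/25"
    using drift_square_times[of r] mult.left_commute[of "(drift r)\<^sup>2" 99 ?e] by linarith
  moreover have "7/25 - 49 * ((drift r)\<^sup>2 * ?e) \<le> potential r x"
    using assms(1,2) by (simp add: stage_state_def mult.assoc)
  ultimately show ?thesis by linarith
qed

lemma stage_progress: "\<tau> \<le> duration s \<Longrightarrow> (drift s)\<^sup>2 * real \<tau> \<le> 1/25"
  using mult_left_mono[of "real \<tau>" "real (duration s)" "(drift s)\<^sup>2"]
  by (simp add: drift_square_times)

text \<open>
  By the hypothesis on \<open>c\<close>, the slope sees the full height \<open>4/5 * \<bar>v s \<bullet> x\<bar>\<close> in the valley. The
  value is then the stored potential plus the zigzag height, less what the drift has cost.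
\<close>
lemma inner_slope_stage:
  assumes "stage_state s \<tau> x" "c * (v s \<bullet> x) = 4/5 * \<bar>v s \<bullet> x\<bar>"
  shows "slope s c \<bullet> x = (\<Sum>r<s. potential r x) - (drift s)\<^sup>2 * real \<tau> + (if \<tau> = 0 then 0 else 8/25)"
proof -
  have "u s \<bullet> x = drift s * real \<tau>" "\<bar>v s \<bullet> x\<bar> = (if \<tau> = 0 then 0 else 2/5)"
    using assms by (auto simp: stage_state_def)
  then show ?thesis
    unfolding inner_slope assms(2) potential_def[symmetric] by (simp add: power2_eq_square)
qed

text \<open>
  The slopes of the current stage attain the maximum. Later slopes see only the stored potential,
  including the part being stored now, and miss the zigzag; the schedule is such that the part being
  stored does not make up for the zigzag before the stage ends. An earlier slope \<open>r\<close> still counts its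
  own zigzag height \<open>8/25\<close>, but misses the potential stored since. This comparison is tight
  at one moment only, the takeover by stage \<open>r + 1\<close>: there the potential \<open>7/25\<close> of stage \<open>r\<close>
  and the penalty \<open>1/25\<close> on its drift add up to exactly \<open>8/25\<close>. Afterwards the zigzag or the potential
  of a further stage gives a margin.
\<close>
lemma slope_active:
  assumes st: "stage_state s \<tau> x" and s: "s < k" and \<tau>: "\<tau> \<le> duration s"
    and c: "c * (v s \<bullet> x) = 4/5 * \<bar>v s \<bullet> x\<bar>" and g: "g \<in> slopes"
  shows "g \<bullet> x \<le> slope s c \<bullet> x"
proof -
  have hpos: "1/4 \<le> potential r x" if "r < s" for r
    using stage_state_potential[OF st that s \<tau>] .
  have prog: "(drift s)\<^sup>2 * real \<tau> \<le> 1/25" using \<tau> by (rule stage_progress)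
  have us: "u s \<bullet> x = drift s * real \<tau>" using st s by (simp add: stage_state_def)
  note active_value = inner_slope_stage[OF st c]
  have max_v: "b * (v r \<bullet> x) \<le> 4/5 * \<bar>v r \<bullet> x\<bar>" if "\<bar>b\<bar> \<le> 4/5" for r b
  proof -
    have "b * (v r \<bullet> x) \<le> \<bar>b\<bar> * \<bar>v r \<bullet> x\<bar>" by (simp flip: abs_mult)
    also have "\<dots> \<le> 4/5 * \<bar>v r \<bullet> x\<bar>" using that by (intro mult_right_mono) auto
    finally show ?thesis .
  qed
  have "slope r b \<bullet> x \<le> slope s c \<bullet> x" if r: "r < k" and b: "\<bar>b\<bar> \<le> 4/5" for r b
  proof -
    consider "r = s" | "s < r" | "r < s" by linarith
    then show ?thesis
    proof cases
      case 1
      then show ?thesis using max_v[OF b, of s] c by (simp add: inner_slope)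
    next
      case 2
      have zero: "u i \<bullet> x = 0" "v i \<bullet> x = 0" if "s < i" "i < k" for i
        using st that by (auto simp: stage_state_def)
      \<comment> \<open>Later drifts have not begun, so only the drift of the current stage is gained.\<close>
      have "(\<Sum>i<r. potential i x) = (\<Sum>i<Suc s. potential i x)"
        using 2 r by (intro sum.mono_neutral_right) (auto simp: potential_def zero)
      then have "slope r b \<bullet> x = (\<Sum>i<s. potential i x) + 7 * ((drift s)\<^sup>2 * real \<tau>)"
        using zero[OF 2 r] us
        by (simp add: inner_slope potential_def power2_eq_square)
      moreover have "8 * ((drift s)\<^sup>2 * real \<tau>) \<le> (if \<tau> = 0 then 0 else 8/25)"
        using prog by (simp add: mult.commute)
      ultimately show ?thesis unfolding active_value by linarith
    next
      case 3
      have "\<bar>v r \<bullet> x\<bar> = 2/5" using st 3 by (simp add: stage_state_def)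
      then have "slope r b \<bullet> x \<le> (\<Sum>i<r. potential i x) - potential r x / 7 + 8/25"
        using max_v[OF b, of r] by (simp add: inner_slope potential_def)
      moreover have "(\<Sum>i<s. potential i x) = (\<Sum>i<r. potential i x) + potential r x + (\<Sum>i\<in>{r<..<s}. potential i x)"
      proof -
        have "{..<s} = {..<Suc r} \<union> {r<..<s}" using 3 by auto
        moreover have "{..<Suc r} \<inter> {r<..<s} = {}" by auto
        ultimately have "(\<Sum>i<s. potential i x) = (\<Sum>i<Suc r. potential i x) + (\<Sum>i\<in>{r<..<s}. potential i x)"
          by (metis sum.union_disjoint finite_lessThan finite_greaterThanLessThan)
        then show ?thesis by simp
      qed
      moreover have rest: "0 \<le> (\<Sum>i\<in>{r<..<s}. potential i x)"
        by (rule sum_nonneg) (use hpos in fastforce)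
      \<comment> \<open>A stage begins at the bottom of its valley, and potential alone must outweigh the zigzag
        height of the earlier stage. The stage just ended has its full potential \<open>7/25\<close>; if it is
        not stage \<open>r\<close> itself, it comes in addition to that of stage \<open>r\<close>.\<close>
      moreover have "8/25 \<le> 8/7 * potential r x + (\<Sum>i\<in>{r<..<s}. potential i x)" if "\<tau> = 0"
      proof -
        have last: "7/25 \<le> potential (s - 1) x"
          using st 3 that unfolding stage_state_def by (auto dest: spec[of _ "s - 1"])
        show ?thesis
        proof (cases "s = Suc r")
          case True
          then have "7/25 \<le> potential r x" using last by simp
          then show ?thesis using rest by linarith
        next
          case False
          have "(\<Sum>i\<in>{s - 1}. potential i x) \<le> (\<Sum>i\<in>{r<..<s}. potential i x)"
            using False 3 hpos by (intro sum_mono2) fastforce+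
          then show ?thesis using last hpos[OF 3] by simp
        qed
      qed
      ultimately show ?thesis using active_value prog hpos[OF 3] by (cases "\<tau> = 0") auto
    qed
  qed
  moreover have "0 \<le> slope s c \<bullet> x"
  proof -
    have "0 \<le> (\<Sum>r<s. potential r x)" by (rule sum_nonneg) (use hpos in fastforce)
    then show ?thesis using active_value prog by (auto split: if_splits)
  qed
  ultimately show ?thesis using g by (auto simp: slopes_def)
qed

text \<open>
  A step across the valley has length \<open>4/5\<close> along \<open>v s\<close> and so exchanges the two positions \<open>\<plusminus>2/5\<close>;
  the first step of a stage, which starts at the bottom, has length \<open>2/5\<close>.
\<close>
lemma stage_state_step:
  assumes st: "stage_state s \<tau> x" and s: "s < k" and \<tau>: "\<tau> < duration s"
  shows "\<exists>y. (x, y) \<in> unit_step (support_fun slopes) \<and> stage_state s (Suc \<tau>) y"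
proof -
  define c where "c = (if v s \<bullet> x = 0 then 2/5 else 4/5 * sgn (v s \<bullet> x))"
  have vs: "\<bar>v s \<bullet> x\<bar> = (if \<tau> = 0 then 0 else 2/5)" using st s by (simp add: stage_state_def)
  have c: "\<bar>c\<bar> \<le> 4/5" "c * (v s \<bullet> x) = 4/5 * \<bar>v s \<bullet> x\<bar>"
    by (auto simp: c_def sgn_if)
  have flip: "\<bar>v s \<bullet> x - c\<bar> = 2/5"
    using vs by (auto simp: c_def sgn_if split: if_splits)
  have "slope s c \<in> slopes" using s c by (auto simp: slopes_def)
  then have "slope s c \<in> subdifferential (support_fun slopes) x"
    using slope_active[OF st s _ c(2)] \<tau>
    by (intro maximizer_in_subdifferential_support_fun[OF norm_slopes]) auto
  then have "(x, x - slope s c) \<in> unit_step (support_fun slopes)" by (auto simp: unit_step_def)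
  moreover have "stage_state s (Suc \<tau>) (x - slope s c)"
    unfolding stage_state_def
  proof (intro conjI allI impI)
    fix r assume r: "r < s"
    have "potential r (x - slope s c) = potential r x - 49 * (drift r)\<^sup>2"
      using r s by (simp add: potential_def inner_diff_right u_slope algebra_simps power2_eq_square)
    then show "7/25 - 49 * (drift r)\<^sup>2 * (real (stage_start s + Suc \<tau>) - real (stage_start (Suc r)))
        \<le> potential r (x - slope s c)"
      using st r by (auto simp: stage_state_def algebra_simps)
    show "\<bar>v r \<bullet> (x - slope s c)\<bar> = 2/5"
      using st r s by (simp add: stage_state_def inner_diff_right v_slope)
  qed (use st s flip in \<open>auto simp: stage_state_def inner_diff_right u_slope v_slope algebra_simps\<close>)
  ultimately show ?thesis by blast
qed

lemma stage_state_next: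
  assumes st: "stage_state s (duration s) x" and s: "Suc s < k"
  shows "stage_state (Suc s) 0 x"
proof -
  have "potential s x = 7/25"
    using st s drift_square_times[of s] by (simp add: stage_state_def potential_def power2_eq_square)
  then show ?thesis
    using st s duration_pos[of s]
    by (auto simp: stage_state_def less_Suc_eq stage_start_def)
qed

lemma reach_stage_state:
  assumes "s < k" "\<tau> \<le> duration s"
  shows "\<exists>x. (0, x) \<in> unit_step (support_fun slopes) ^^ (stage_start s + \<tau>) \<and> stage_state s \<tau> x"
  using assms
proof (induction s arbitrary: \<tau>)
  case (0 \<tau>)
  then show ?case
  proof (induction \<tau>)
    case 0
    then show ?case by (auto simp: stage_start_def stage_state_def)
  next
    case (Suc \<tau>)
    then show ?case using stage_state_step[of 0 \<tau>] by simp (meson Suc_le_lessD relcompI)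
  qed
next
  case (Suc s \<tau>)
  then have "Suc s < k" by simp
  from Suc.prems(2) show ?case
  proof (induction \<tau>)
    case 0
    then show ?case using Suc.IH[of "duration s"] Suc.prems(1) stage_state_next[of s]
      by (auto simp: stage_start_def)
  next
    case (Suc \<tau>)
    then show ?case using stage_state_step[of "Suc s" \<tau>] \<open>Suc s < k\<close> by simp (meson Suc_le_lessD relcompI)
  qed
qed

text \<open>
  No slope collects the potential stored in the last stage, so its end point is measured by the slope
  of that stage itself, which sees the \<open>k - 1\<close> potentials of at least \<open>1/4\<close>, the zigzag height \<open>8/25\<close>,
  and the loss \<open>1/25\<close> by drifting.
\<close>
lemma high_point_reachable:
  obtains N x where "N \<le> 100 ^ k" "(0, x) \<in> unit_step (support_fun slopes) ^^ N"
    "real k / 4 \<le> support_fun slopes x"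
proof -
  define s where "s = k - 1"
  have s: "s < k" "Suc s = k" using k_pos by (auto simp: s_def)
  obtain x where x: "(0, x) \<in> unit_step (support_fun slopes) ^^ (stage_start s + duration s)"
    and st: "stage_state s (duration s) x"
    using reach_stage_state[OF s(1) order_refl] by blast
  have "stage_start s + duration s = stage_start (Suc s)" by (simp add: stage_start_def)
  then have N: "stage_start s + duration s \<le> 100 ^ k"
    using stage_start_closed[of k] s(2) by simp
  define c where "c = 4/5 * sgn (v s \<bullet> x)"
  have c: "\<bar>c\<bar> \<le> 4/5" "c * (v s \<bullet> x) = 4/5 * \<bar>v s \<bullet> x\<bar>"
    by (auto simp: c_def sgn_if)
  have "real s * (1/4) \<le> (\<Sum>r<s. potential r x)"
    using sum_bounded_below[of "{..<s}" "1/4" "\<lambda>r. potential r x"] stage_state_potential[OF st _ s(1)]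
    by simp
  moreover have k_eq: "real k = real s + 1" using s(2) by linarith
  ultimately have "real k / 4 \<le> slope s c \<bullet> x"
    using inner_slope_stage[OF st c(2)] drift_square_times[of s] duration_pos[of s] k_eq
    by simp
  also have "\<dots> \<le> support_fun slopes x"
    using s(1) c by (intro inner_le_support_fun[OF norm_slopes]) (auto simp: slopes_def)
  finally show ?thesis using that N x by blast
qed

end

section \<open>Exact gap in Euclidean space\<close>

lemma min_value_eq:
  assumes "is_arg_min f (\<lambda>_. True) (z :: 'a)"
  shows "min_value f = f z"
  unfolding min_value_def using assms by (intro Least_equality) (auto simp: is_arg_min_linorder)

lemma orthonormal_pairs_exist:
  assumes "0 < k" "2 * k \<le> CARD('d::finite)"
  obtains u v :: "nat \<Rightarrow> real ^ 'd" where "orthonormal_pairs u v k"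
proof -
  obtain e :: "nat \<Rightarrow> 'd" where e: "inj_on e {..<2 * k}"
    using card_le_inj[of "{..<2 * k}" "UNIV :: 'd set"] assms(2) by auto
  have "e i = e j \<longleftrightarrow> i = j" if "i < 2 * k" "j < 2 * k" for i j
    using e that by (auto simp: inj_on_def)
  then have "orthonormal_pairs (\<lambda>r. axis (e (2 * r)) 1 :: real ^ 'd) (\<lambda>r. axis (e (2 * r + 1)) 1) k"
    using assms(1) by unfold_locales (auto simp: inner_axis_axis, presburger+)
  then show ?thesis by (rule that)
qed

theorem theorem3:
  fixes k :: nat and \<eta> L :: real
  assumes "k \<ge> 1" and "CARD('d::finite) \<ge> 2 * k + 1" and "\<eta> > 0" and "L > 0"
  shows "\<exists>(n\<^sub>k::nat) (f :: real ^ 'd \<Rightarrow> real) (x :: nat \<Rightarrow> real ^ 'd) (g :: nat \<Rightarrow> real ^ 'd).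
    0 < n\<^sub>k \<and> n\<^sub>k \<le> 1000 ^ (k + 1) \<and>
    convex_on UNIV f \<and> lipschitz_on L UNIV f \<and> is_arg_min f (\<lambda>_. True) 0 \<and>
    x 1 = 0 \<and> subgradient_trajectory f \<eta> n\<^sub>k x g \<and>
    f (x n\<^sub>k) - min_value f = real k / 4 * \<eta> * L\<^sup>2 \<and>
    (\<forall>n\<ge>n\<^sub>k. 0 \<in> subdifferential f 0 \<and>
      (\<exists>y :: nat \<Rightarrow> real ^ 'd.
        y 1 = 0 \<and> subgradient_trajectory f \<eta> n y (prefix_zeros (n - n\<^sub>k) g) \<and>
        f (y n) - min_value f = real k / 4 * \<eta> * L\<^sup>2))"
proof -
  obtain u v :: "nat \<Rightarrow> real ^ 'd" where "orthonormal_pairs u v k"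
    using orthonormal_pairs_exist[of k, where 'd = 'd] assms(1,2) by auto
  then interpret orthonormal_pairs u v k .
  let ?F = "support_fun slopes"
  obtain N p where N: "N \<le> 100 ^ k" and p: "(0, p) \<in> unit_step ?F ^^ N" "real k / 4 \<le> ?F p"
    by (rule high_point_reachable)
  have ne: "slopes \<noteq> {}" by (auto simp: slopes_def)
  have zero_slope: "0 \<in> slopes" by (simp add: slopes_def)
  have F0: "?F 0 = 0" using ne by (simp add: support_fun_def)
  have F_nonneg: "0 \<le> ?F x" for x
    using inner_le_support_fun[of slopes 1 0 x] norm_slopes zero_slope by simp
  have gap: "0 < ?F p" using p(2) assms(1) by simp
  \<comment> \<open>The factor under the root is at most \<open>1\<close> and cancels the excess of the climb over \<open>k / 4\<close>.\<close>
  define c where "c = L * sqrt (real k / 4 / ?F p)"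
  have c: "0 < c" "c \<le> L" using gap p(2) assms(1,4)
    by (auto simp: c_def intro!: mult_left_le real_le_lsqrt)
  define f where "f = rescale \<eta> c ?F"
  obtain x g where x: "x 1 = 0" "x (Suc N) = (\<eta> * c) *\<^sub>R p" "subgradient_trajectory f \<eta> (Suc N) x g"
    using subgradient_trajectory_of_unit_steps[OF assms(3) c(1) p(1)] unfolding f_def by auto
  have "f 0 = 0" by (simp add: f_def rescale_def F0)
  moreover have "0 \<le> f z" for z using assms(3) by (simp add: f_def rescale_def F_nonneg)
  ultimately have argmin: "is_arg_min f (\<lambda>_. True) 0" and zero: "0 \<in> subdifferential f 0"
    by (auto simp: is_arg_min_linorder subdifferential_def)
  have "f (x (Suc N)) = \<eta> * c\<^sup>2 * ?F p" using assms(3) c(1) by (simp add: x(2) f_def rescale_def field_simps)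
  also have "\<dots> = real k / 4 * \<eta> * L\<^sup>2" using gap by (simp add: c_def power_mult_distrib)
  finally have final: "f (x (Suc N)) - min_value f = real k / 4 * \<eta> * L\<^sup>2"
    using \<open>f 0 = 0\<close> min_value_eq[OF argmin] by simp
  have "(100::nat) ^ k \<le> 1000 ^ k" "(1::nat) \<le> 1000 ^ k" by (auto intro: power_mono)
  then have count: "Suc N \<le> 1000 ^ (k + 1)" using N unfolding power_add power_one_right by linarith
  have "convex_on UNIV f" "lipschitz_on L UNIV f"
    unfolding f_def using assms(3) c
    by (auto intro!: convex_on_rescale convex_on_support_fun[OF ne norm_slopes]
        lipschitz_on_rescale[THEN lipschitz_on_le] lipschitz_on_support_fun[OF ne norm_slopes])
  moreover have "\<exists>y. y 1 = 0 \<and> subgradient_trajectory f \<eta> n y (prefix_zeros (n - Suc N) g) \<and>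
      f (y n) - min_value f = real k / 4 * \<eta> * L\<^sup>2" if "n \<ge> Suc N" for n
  proof (intro exI conjI)
    let ?m = "n - Suc N"
    show "prefix_zeros ?m x 1 = 0" using x(1) by (simp add: prefix_zeros_def)
    show "subgradient_trajectory f \<eta> n (prefix_zeros ?m x) (prefix_zeros ?m g)"
      using subgradient_trajectory_prefix_zeros[OF x(3,1) zero, of ?m] that by simp
    show "f (prefix_zeros ?m x n) - min_value f = real k / 4 * \<eta> * L\<^sup>2"
    proof -
      have "\<not> n \<le> ?m" "n - ?m = Suc N" using that by linarith+
      then show ?thesis using final by (simp only: prefix_zeros_def if_False)
    qed
  qed
  ultimately show ?thesis using count x(1,3) final argmin zero
    by (intro exI[of _ "Suc N"] exI[of _ f] exI[of _ x] exI[of _ g]) auto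
qed

end
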